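(* Consider the Nash equilibrium problem (NEP) of the context (all variables continuous). Suppose that Assumption A holds with constants $\alpha\in[0,1)$ and $\mathbf w\in\mathbb R^N$, $w_\nu>0$. Let $\{\mathbf x^k\}_{k\in\mathbb N}\subseteq X$ be the sequence generated by the Jacobi-type continuous best-response method with index sets $\{\mathcal J^k\}_{k\in\mathbb N}$, and assume that there is an integer $h\ge1$ such that every $h$ iterations at least one best response of any player is computed, that is, $\nu\in\bigcup_{t=k}^{k+h-1}\mathcal J^t$ for every player $\nu\in\mathcal I$ and every iteration $k$. Then the NEP has a unique equilibrium $\overline{\mathbf x}$, and the following hold. (i) Assume $\mathbf x^0\ne\overline{\mathbf x}$ (and $\alpha>0$, so that $\log_\alpha$ is defined) and, for every $\varepsilon>0$, let $$\widehat k_\varepsilon := h\left\lceil\log_\alpha\left(\min\left\{\frac{\varepsilon}{\max_{\nu\in\mathcal I}w_\nu\|x^{0,\nu}-\overline x^\nu\|},\ 1\right\}\right)\right\rceil .$$ For all $k\ge\widehat k_\varepsilon$, the point $\mathbf x^k$ satisfies $\max_{\nu\in\mathcal I}w_\nu\|x^{k,\nu}-\overline x^\nu\|\le\varepsilon$. (ii) The sequence $\{\mathbf x^k\}_{k\in\mathbb N}$ converges to the unique equilibrium $\overline{\mathbf x}$ of the NEP.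
   Context: NEP. There are $N$ players, $\mathcal I=\{1,\dots,N\}$. Player $\nu$ controls $x^\nu\in\mathbb R^{n_\nu}$; $\mathbf x=(x^\nu)_{\nu\in\mathcal I}\in\mathbb R^n$, $n=\sum_\nu n_\nu$; $\mathbf x^{-\nu}$ collects the strategies of all players other than $\nu$. Given $\mathbf x^{-\nu}$, player $\nu$ solves $\min_{x^\nu}\theta_\nu(x^\nu,\mathbf x^{-\nu})$ s.t. $x^\nu\in X_\nu$, where $\theta_\nu:\mathbb R^n\to\mathbb R$ is continuously differentiable and convex with respect to $x^\nu$, and $X_\nu\subseteq\mathbb R^{n_\nu}$ is nonempty, closed and convex (possibly unbounded). Put $X=\prod_\nu X_\nu$. Standing assumption: each player's problem has a solution for every given $\mathbf x^{-\nu}$. Continuous best response: $T_\nu(\mathbf x^{-\nu})=\arg\min\{\theta_\nu(x^\nu,\mathbf x^{-\nu}) : x^\nu\in X_\nu\}$. It is assumed throughout that $T=(T_\nu)_\nu$ is single-valued on $X$. Equilibrium: $\overline{\mathbf x}\in X$ with $\overline x^\nu=T_\nu(\overline{\mathbf x}^{-\nu})$ for all $\nu\in\mathcal I$. $\|\cdot\|$ is any given norm. Assumption A: there exist $\alpha\in[0,1)$ and $\mathbf w\in\mathbb R^N$ with $w_\nu>0$ for all $\nu$ such that for all $\mathbf z,\mathbf y\in X$: $\max_{\nu}w_\nu\|T_\nu(\mathbf z^{-\nu})-T_\nu(\mathbf y^{-\nu})\|\le\alpha\max_\nu w_\nu\|z^\nu-y^\nu\|$. Jacobi-type continuous best-response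 method: start from $\mathbf x^0\in X$; at each iteration $k=0,1,\dots$ select a subset $\mathcal J^k\subseteq\mathcal I$; for $\nu\in\mathcal J^k$ set $x^{k+1,\nu}=T_\nu(\mathbf x^{k,-\nu})$; for $\nu\notin\mathcal J^k$ set $x^{k+1,\nu}=x^{k,\nu}$. *)

theory Defs
  imports "HOL-Analysis.Analysis"
begin

text \<open>
  The strategy space \<open>\<real>\<^sup>n\<close> is \<^typ>\<open>real ^ 'n\<close>, and a map \<open>own :: 'n \<Rightarrow> 'p\<close> assigns every coordinate
  to the player controlling it. The space of player \<open>\<nu>\<close>, of dimension \<open>card {j. own j = \<nu>}\<close>, is
  the coordinate subspace of vectors vanishing outside the coordinates of \<open>\<nu>\<close>; different players
  may thus have different dimensions. The profile \<open>(y, x\<^sup>-\<^sup>\<nu>)\<close> is the sum \<open>y + rivals own \<nu> x\<close>.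
\<close>

definition strategy_space :: "('n::finite \<Rightarrow> 'p) \<Rightarrow> 'p \<Rightarrow> (real ^ 'n) set" where
  "strategy_space own \<nu> = {y. \<forall>j. own j \<noteq> \<nu> \<longrightarrow> y $ j = 0}"

definition strategy :: "('n::finite \<Rightarrow> 'p) \<Rightarrow> 'p \<Rightarrow> real ^ 'n \<Rightarrow> real ^ 'n" where
  "strategy own \<nu> x = (\<chi> j. if own j = \<nu> then x $ j else 0)"

definition rivals :: "('n::finite \<Rightarrow> 'p) \<Rightarrow> 'p \<Rightarrow> real ^ 'n \<Rightarrow> real ^ 'n" where
  "rivals own \<nu> x = (\<chi> j. if own j = \<nu> then 0 else x $ j)"

lemma strategy_plus_rivals: "strategy own \<nu> x + rivals own \<nu> x = x"
  by (simp add: strategy_def rivals_def vec_eq_iff)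

definition feasible :: "('n::finite \<Rightarrow> 'p) \<Rightarrow> ('p \<Rightarrow> (real ^ 'n) set) \<Rightarrow> (real ^ 'n) set" where
  "feasible own X = {x. \<forall>\<nu>. strategy own \<nu> x \<in> X \<nu>}"

definition continuously_differentiable :: "('a::real_normed_vector \<Rightarrow> real) \<Rightarrow> bool" where
  "continuously_differentiable f \<longleftrightarrow>
     (\<exists>f' :: 'a \<Rightarrow> 'a \<Rightarrow>\<^sub>L real.
        (\<forall>x. (f has_derivative blinfun_apply (f' x)) (at x)) \<and> continuous_on UNIV f')"

definition is_norm_on :: "'a::real_vector set \<Rightarrow> ('a \<Rightarrow> real) \<Rightarrow> bool" where
  "is_norm_on S f \<longleftrightarrow>
     (\<forall>x\<in>S. 0 \<le> f x \<and> (f x = 0 \<longleftrightarrow> x = 0)) \<and>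
     (\<forall>c. \<forall>x\<in>S. f (c *\<^sub>R x) = \<bar>c\<bar> * f x) \<and>
     (\<forall>x\<in>S. \<forall>y\<in>S. f (x + y) \<le> f x + f y)"

definition is_best_response ::
  "('p \<Rightarrow> real ^ 'n::finite \<Rightarrow> real) \<Rightarrow> ('p \<Rightarrow> (real ^ 'n) set) \<Rightarrow> 'p \<Rightarrow> real ^ 'n \<Rightarrow> real ^ 'n \<Rightarrow> bool"
  where "is_best_response \<theta> X \<nu> r y \<longleftrightarrow> is_arg_min (\<lambda>y. \<theta> \<nu> (y + r)) (\<lambda>y. y \<in> X \<nu>) y"

text \<open>The argument \<open>r\<close> is meant to be a vector \<open>rivals own \<nu> x\<close>. The value is a choice among the
  minimizers, hence meaningful only where the minimizer exists and is unique.\<close>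

definition best_response ::
  "('p \<Rightarrow> real ^ 'n::finite \<Rightarrow> real) \<Rightarrow> ('p \<Rightarrow> (real ^ 'n) set) \<Rightarrow> 'p \<Rightarrow> real ^ 'n \<Rightarrow> real ^ 'n"
  where "best_response \<theta> X \<nu> r = arg_min_on (\<lambda>y. \<theta> \<nu> (y + r)) (X \<nu>)"

definition equilibrium ::
  "('n::finite \<Rightarrow> 'p) \<Rightarrow> ('p \<Rightarrow> real ^ 'n \<Rightarrow> real) \<Rightarrow> ('p \<Rightarrow> (real ^ 'n) set) \<Rightarrow> real ^ 'n \<Rightarrow> bool"
  where "equilibrium own \<theta> X x \<longleftrightarrow>
    x \<in> feasible own X \<and> (\<forall>\<nu>. strategy own \<nu> x = best_response \<theta> X \<nu> (rivals own \<nu> x))"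

text \<open>\<open>nrm \<nu>\<close> is the norm on the strategy space of player \<open>\<nu>\<close>.\<close>

definition assumption_A ::
  "('n::finite \<Rightarrow> 'p::finite) \<Rightarrow> ('p \<Rightarrow> real ^ 'n \<Rightarrow> real) \<Rightarrow> ('p \<Rightarrow> (real ^ 'n) set) \<Rightarrow>
   ('p \<Rightarrow> real ^ 'n \<Rightarrow> real) \<Rightarrow> real \<Rightarrow> real ^ 'p \<Rightarrow> bool"
  where "assumption_A own \<theta> X nrm \<alpha> w \<longleftrightarrow>
    0 \<le> \<alpha> \<and> \<alpha> < 1 \<and> (\<forall>\<nu>. 0 < w $ \<nu>) \<and>
    (\<forall>z\<in>feasible own X. \<forall>y\<in>feasible own X.
       (MAX \<nu>. w $ \<nu> * nrm \<nu> (best_response \<theta> X \<nu> (rivals own \<nu> z)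
                                - best_response \<theta> X \<nu> (rivals own \<nu> y)))
       \<le> \<alpha> * (MAX \<nu>. w $ \<nu> * nrm \<nu> (strategy own \<nu> z - strategy own \<nu> y)))"

definition jacobi_sequence ::
  "('n::finite \<Rightarrow> 'p) \<Rightarrow> ('p \<Rightarrow> real ^ 'n \<Rightarrow> real) \<Rightarrow> ('p \<Rightarrow> (real ^ 'n) set) \<Rightarrow>
   (nat \<Rightarrow> 'p set) \<Rightarrow> (nat \<Rightarrow> real ^ 'n) \<Rightarrow> bool"
  where "jacobi_sequence own \<theta> X J x \<longleftrightarrow>
    x 0 \<in> feasible own X \<and>
    (\<forall>k \<nu>. strategy own \<nu> (x (Suc k)) =
       (if \<nu> \<in> J k then best_response \<theta> X \<nu> (rivals own \<nu> (x k)) else strategy own \<nu> (x k)))"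

end

theory Submission
  imports Defs
begin

text \<open>
  The weighted maximum of the players' norms is a norm on the whole strategy space, for which the
  joint best response is an \<open>\<alpha>\<close>-contraction. All norms on a Euclidean space being equivalent, some
  iterate of it is a contraction for the Euclidean norm, which gives the equilibrium. Along the
  method no player's weighted error exceeds the current maximal error, and it is at most \<open>\<alpha>\<close> times
  that maximum once the player has been updated; so the maximal error shrinks by \<open>\<alpha>\<close> every \<open>h\<close>
  iterations.
\<close>

section \<open>Contractions for an arbitrary norm\<close>

text \<open>A norm is convex, hence continuous in finite dimension, so it attains a minimum and a
  maximum on the compact unit sphere. These are the two constants, and homogeneity carries the
  bounds to all vectors.\<close>

lemma is_norm_on_UNIV_equivalent:
  fixes f :: "'a::euclidean_space \<Rightarrow> real"
  assumes "is_norm_on UNIV f"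
  obtains c C where "c > 0" "C > 0" "\<And>v. c * norm v \<le> f v" "\<And>v. f v \<le> C * norm v"
proof -
  have pos: "0 \<le> f v" "f v = 0 \<longleftrightarrow> v = 0" and scale: "f (a *\<^sub>R v) = \<bar>a\<bar> * f v"
    and tri: "f (u + v) \<le> f u + f v" for a u v
    using assms by (auto simp: is_norm_on_def)
  have "convex_on UNIV f"
  proof (rule convex_onI)
    fix t :: real and u v :: 'a
    assume "0 < t" "t < 1"
    then show "f ((1 - t) *\<^sub>R u + t *\<^sub>R v) \<le> (1 - t) * f u + t * f v"
      using tri[of "(1 - t) *\<^sub>R u" "t *\<^sub>R v"] by (simp add: scale)
  qed simp
  then have cont: "continuous_on (sphere 0 1) f"
    using convex_on_continuous[of UNIV f] continuous_on_subset by blast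
  have ne: "sphere (0::'a) 1 \<noteq> {}" by simp
  obtain a where a: "a \<in> sphere 0 1" "\<And>u. u \<in> sphere 0 1 \<Longrightarrow> f a \<le> f u"
    using continuous_attains_inf[OF compact_sphere ne cont] by blast
  obtain b where b: "b \<in> sphere 0 1" "\<And>u. u \<in> sphere 0 1 \<Longrightarrow> f u \<le> f b"
    using continuous_attains_sup[OF compact_sphere ne cont] by blast
  have f_sgn: "f v = f (sgn v) * norm v" for v
    using scale[of "norm v" "sgn v"] by (cases "v = 0") (auto simp: sgn_div_norm pos)
  have sgn_sphere: "sgn v \<in> sphere 0 1" if "v \<noteq> 0" for v :: 'a
    using that by (simp add: norm_sgn)
  have f0: "f 0 = 0" by (simp add: pos)
  show thesis
  proof
    have "a \<noteq> 0" "b \<noteq> 0" using a(1) b(1) by auto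
    then show "f a > 0" "f b > 0" using pos by (metis less_eq_real_def)+
    show "f a * norm v \<le> f v" for v
      using a(2)[OF sgn_sphere[of v]] f_sgn[of v] f0
      by (cases "v = 0") (auto intro: mult_right_mono)
    show "f v \<le> f b * norm v" for v
      using b(2)[OF sgn_sphere[of v]] f_sgn[of v] f0
      by (cases "v = 0") (auto intro: mult_right_mono)
  qed
qed

text \<open>\<open>Banach_fix\<close> works with the Euclidean distance, for which \<open>T\<close>
  itself may expand. It is applied to a power of \<open>T\<close> instead, and the fixed point is
  then carried back to \<open>T\<close>.\<close>

lemma contraction_unique_fixpoint:
  fixes f :: "'a::euclidean_space \<Rightarrow> real" and T :: "'a \<Rightarrow> 'a"
  assumes norm: "is_norm_on UNIV f" and S: "closed S" "S \<noteq> {}" and T: "T ` S \<subseteq> S"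
    and \<alpha>: "0 \<le> \<alpha>" "\<alpha> < 1"
    and contraction: "\<And>y z. y \<in> S \<Longrightarrow> z \<in> S \<Longrightarrow> f (T y - T z) \<le> \<alpha> * f (y - z)"
  shows "\<exists>!y. y \<in> S \<and> T y = y"
proof -
  obtain c C where c: "c > 0" "C > 0" "\<And>v. c * norm v \<le> f v" "\<And>v. f v \<le> C * norm v"
    using is_norm_on_UNIV_equivalent[OF norm] by metis
  have in_S: "(T ^^ n) y \<in> S" if "y \<in> S" for n y
    using T that by (induction n) auto
  have iterate: "f ((T ^^ n) y - (T ^^ n) z) \<le> \<alpha> ^ n * f (y - z)" if "y \<in> S" "z \<in> S" for n y z
  proof (induction n)
    case (Suc n)
    have "f ((T ^^ Suc n) y - (T ^^ Suc n) z) \<le> \<alpha> * f ((T ^^ n) y - (T ^^ n) z)"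
      using contraction in_S that by simp
    also have "\<dots> \<le> \<alpha> * (\<alpha> ^ n * f (y - z))"
      using Suc \<alpha> by (intro mult_left_mono)
    finally show ?case by simp
  qed simp
  \<comment> \<open>Switching between \<open>f\<close> and the Euclidean norm costs a factor
    \<open>C / c\<close>; this \<open>n\<close> makes \<open>\<alpha> ^ n\<close> absorb it and
    leaves the constant 1/2.\<close>
  obtain n where n: "\<alpha> ^ n < c / (2 * C)"
    using real_arch_pow_inv[of "c / (2 * C)" \<alpha>] c(1,2) \<alpha> by auto
  have lip: "dist ((T ^^ n) y) ((T ^^ n) z) \<le> 1 / 2 * dist y z" if "y \<in> S" "z \<in> S" for y z
  proof -
    have "c * norm ((T ^^ n) y - (T ^^ n) z) \<le> \<alpha> ^ n * f (y - z)"
      using c(3) iterate[OF that] order_trans by blast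
    also have "\<dots> \<le> c / (2 * C) * (C * norm (y - z))"
      using n c \<alpha> assms(1) by (intro mult_mono) (auto simp: is_norm_on_def)
    also have "\<dots> = c * (1 / 2 * norm (y - z))"
      using c(2) by simp
    finally show ?thesis
      unfolding dist_norm using c(1) mult_le_cancel_left_pos by blast
  qed
  have "\<exists>!y\<in>S. (T ^^ n) y = y"
    using in_S lip S by (intro Banach_fix[where c = "1 / 2"]) (auto simp: complete_eq_closed)
  then obtain y where y: "y \<in> S" "(T ^^ n) y = y"
    and y_unique: "\<And>z. z \<in> S \<Longrightarrow> (T ^^ n) z = z \<Longrightarrow> z = y"
    by blast
  \<comment> \<open>\<open>T\<close> commutes with its power, so \<open>T y\<close> is a fixed point
    of the power too and must coincide with \<open>y\<close>.\<close>
  have "(T ^^ n) (T y) = T y"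
    using y(2) funpow_swap1[of T n y] by simp
  then have "T y = y"
    using T y(1) y_unique by blast
  \<comment> \<open>Uniqueness passes to \<open>T\<close> because its fixed points are among those
    of the power.\<close>
  moreover have "(T ^^ n) z = z" if "T z = z" for z
    using that by (induction n) auto
  ultimately show ?thesis
    using y(1) y_unique by blast
qed

section \<open>Asynchronous error reduction\<close>

lemma Max_range_le_iff:
  fixes g :: "'p::finite \<Rightarrow> 'a::linorder"
  shows "(MAX \<nu>. g \<nu>) \<le> b \<longleftrightarrow> (\<forall>\<nu>. g \<nu> \<le> b)"
  by (subst Max_le_iff) auto

lemma le_Max_range:
  fixes g :: "'p::finite \<Rightarrow> 'a::linorder"
  shows "g \<nu> \<le> (MAX \<nu>. g \<nu>)"
  by (intro Max_ge) auto

text \<open>The game is abstracted away: \<open>d k \<nu>\<close> stands for the weighted error of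
  player \<open>\<nu>\<close> at iteration \<open>k\<close>. The exponent counts the complete blocks
  of \<open>h\<close> iterations.\<close>

lemma asynchronous_error_bound:
  fixes d :: "nat \<Rightarrow> 'p::finite \<Rightarrow> real"
  assumes \<alpha>: "0 \<le> \<alpha>" "\<alpha> \<le> 1" and nonneg: "\<And>k \<nu>. 0 \<le> d k \<nu>"
    and updated: "\<And>k \<nu>. \<nu> \<in> J k \<Longrightarrow> d (Suc k) \<nu> \<le> \<alpha> * (MAX \<mu>. d k \<mu>)"
    and kept: "\<And>k \<nu>. \<nu> \<notin> J k \<Longrightarrow> d (Suc k) \<nu> = d k \<nu>"
    and cover: "\<And>k \<nu>. \<nu> \<in> (\<Union>t\<in>{k..<k + h}. J t)"
  shows "(MAX \<nu>. d k \<nu>) \<le> \<alpha> ^ (k div h) * (MAX \<nu>. d 0 \<nu>)"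
proof -
  define D where "D k = (MAX \<nu>. d k \<nu>)" for k
  have d_le: "d k \<nu> \<le> D k" for k \<nu>
    unfolding D_def by (rule le_Max_range)
  have D_nonneg: "0 \<le> D k" for k
    using nonneg d_le order_trans by blast
  have "D (Suc k) \<le> D k" for k
    unfolding D_def[of "Suc k"] Max_range_le_iff
  proof
    fix \<nu>
    show "d (Suc k) \<nu> \<le> D k"
    proof (cases "\<nu> \<in> J k")
      case True
      then have "d (Suc k) \<nu> \<le> \<alpha> * D k" using updated D_def by metis
      also have "\<dots> \<le> D k" using \<alpha> D_nonneg mult_left_le_one_le by blast
      finally show ?thesis .
    qed (simp add: kept d_le)
  qed
  then have anti: "D l \<le> D k" if "k \<le> l" for k l
    using that lift_Suc_antimono_le[of D] by blast
  \<comment> \<open>Induction on the window length. An update in the last iteration gives the bound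
    because \<open>D\<close> has not grown since \<open>k\<close>; otherwise an earlier update gave
    it and the error is kept.\<close>
  have partial: "d (k + j) \<nu> \<le> \<alpha> * D k" if "\<nu> \<in> (\<Union>t\<in>{k..<k + j}. J t)" for k j \<nu>
    using that
  proof (induction j)
    case (Suc j)
    show ?case
    proof (cases "\<nu> \<in> J (k + j)")
      case True
      then have "d (k + Suc j) \<nu> \<le> \<alpha> * D (k + j)" using updated D_def by simp
      also have "\<dots> \<le> \<alpha> * D k" using \<alpha> anti by (simp add: mult_left_mono)
      finally show ?thesis .
    next
      case False
      with Suc.prems have "\<nu> \<in> (\<Union>t\<in>{k..<k + j}. J t)"
        by (auto simp: less_Suc_eq)
      with Suc.IH False show ?thesis by (simp add: kept)
    qed
  qed simp
  have block: "D (k + h) \<le> \<alpha> * D k" for k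
    unfolding D_def[of "k + h"] Max_range_le_iff using partial cover by blast
  have blocks: "D (m * h) \<le> \<alpha> ^ m * D 0" for m
  proof (induction m)
    case (Suc m)
    have "D (Suc m * h) \<le> \<alpha> * D (m * h)" using block[of "m * h"] by (simp add: add.commute)
    also have "\<dots> \<le> \<alpha> * (\<alpha> ^ m * D 0)" using Suc \<alpha> by (intro mult_left_mono)
    finally show ?case by simp
  qed simp
  \<comment> \<open>The iterations after the last complete block cannot increase the error.\<close>
  have "D k \<le> D (k div h * h)" by (rule anti) simp
  also note blocks[of "k div h"]
  finally show ?thesis by (simp only: D_def)
qed

section \<open>The best-response method\<close>

lemma linear_strategy: "linear (strategy own \<nu>)"
  by (rule linearI) (auto simp: strategy_def vec_eq_iff)

lemma strategy_in_strategy_space: "strategy own \<nu> v \<in> strategy_space own \<nu>"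
  by (simp add: strategy_def strategy_space_def)

lemma strategy_eq_iff: "x = y \<longleftrightarrow> (\<forall>\<nu>. strategy own \<nu> x = strategy own \<nu> y)"
  by (auto simp: strategy_def vec_eq_iff)

lemma closed_feasible:
  assumes "\<And>\<nu>. closed (X \<nu>)"
  shows "closed (feasible own X)"
proof -
  have "feasible own X = (\<Inter>\<nu>. strategy own \<nu> -` X \<nu>)"
    by (auto simp: feasible_def)
  moreover have "closed (strategy own \<nu> -` X \<nu>)" for \<nu>
    using assms linear_strategy
    by (intro continuous_closed_vimage linear_continuous_at) (auto simp: linear_linear)
  ultimately show ?thesis by auto
qed

text \<open>Each \<open>nrm \<nu>\<close> is a norm only on its coordinate subspace. Definiteness on
  the whole space holds because every coordinate has an owner, so a vector with all projections zero
  is zero.\<close>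

lemma is_norm_on_weighted_max:
  fixes own :: "'n::finite \<Rightarrow> 'p::finite"
  assumes norms: "\<And>\<nu>. is_norm_on (strategy_space own \<nu>) (nrm \<nu>)" and w: "\<And>\<nu>. 0 < w $ \<nu>"
  shows "is_norm_on UNIV (\<lambda>v. MAX \<nu>. w $ \<nu> * nrm \<nu> (strategy own \<nu> v))"
proof -
  let ?N = "\<lambda>v \<nu>. w $ \<nu> * nrm \<nu> (strategy own \<nu> v)"
  have nonneg: "0 \<le> ?N v \<nu>" and zero: "?N v \<nu> = 0 \<longleftrightarrow> strategy own \<nu> v = 0"
    and scale: "?N (a *\<^sub>R v) \<nu> = \<bar>a\<bar> * ?N v \<nu>" and tri: "?N (u + v) \<nu> \<le> ?N u \<nu> + ?N v \<nu>"
    for a u v \<nu>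
  proof -
    note n = norms[of \<nu>, unfolded is_norm_on_def] strategy_in_strategy_space[of own \<nu>]
    show "0 \<le> ?N v \<nu>" "?N v \<nu> = 0 \<longleftrightarrow> strategy own \<nu> v = 0"
      using n w[of \<nu>] by auto
    show "?N (a *\<^sub>R v) \<nu> = \<bar>a\<bar> * ?N v \<nu>"
      using n by (simp add: linear_cmul[OF linear_strategy])
    have "?N (u + v) \<nu> \<le> w $ \<nu> * (nrm \<nu> (strategy own \<nu> u) + nrm \<nu> (strategy own \<nu> v))"
      using n w[of \<nu>] by (simp add: linear_add[OF linear_strategy])
    then show "?N (u + v) \<nu> \<le> ?N u \<nu> + ?N v \<nu>" by (simp add: distrib_left)
  qed
  have max_nonneg: "0 \<le> (MAX \<nu>. ?N v \<nu>)" for v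
    using order_trans[OF nonneg[where v = v] le_Max_range[of "?N v"]] .
  have "(MAX \<nu>. ?N v \<nu>) = 0 \<longleftrightarrow> v = 0" for v
  proof -
    have "(MAX \<nu>. ?N v \<nu>) = 0 \<longleftrightarrow> (\<forall>\<nu>. ?N v \<nu> \<le> 0)"
      unfolding Max_range_le_iff[symmetric] using max_nonneg[of v]
      by (simp only: order.eq_iff[of _ "0::real"] simp_thms)
    also have "\<dots> \<longleftrightarrow> (\<forall>\<nu>. strategy own \<nu> v = 0)"
      using nonneg[where v = v] zero[where v = v] by (metis order.antisym order.refl)
    also have "\<dots> \<longleftrightarrow> v = 0"
      using strategy_eq_iff[of v 0 own] by (simp add: linear_0[OF linear_strategy])
    finally show ?thesis .
  qed
  moreover have "(MAX \<nu>. ?N (a *\<^sub>R v) \<nu>) = \<bar>a\<bar> * (MAX \<nu>. ?N v \<nu>)" for a v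
  proof -
    \<comment> \<open>Multiplication by a nonnegative number is monotone and so commutes with a
      finite maximum.\<close>
    have "\<bar>a\<bar> * Max (range (?N v)) = Max ((*) \<bar>a\<bar> ` range (?N v))"
      by (intro mono_Max_commute) (auto simp: mono_def mult_left_mono)
    then show ?thesis by (simp add: scale image_image)
  qed
  moreover have "(MAX \<nu>. ?N (u + v) \<nu>) \<le> (MAX \<nu>. ?N u \<nu>) + (MAX \<nu>. ?N v \<nu>)" for u v
    unfolding Max_range_le_iff
    by (rule allI, rule order_trans[OF tri], rule add_mono) (rule le_Max_range)+
  ultimately show ?thesis
    using max_nonneg by (auto simp: is_norm_on_def)
qed

text \<open>The choice behind \<open>best_response\<close> returns a minimizer as soon as one
  exists.\<close>

lemma best_response_in_strategies:
  assumes "is_best_response \<theta> X \<nu> r y"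
  shows "best_response \<theta> X \<nu> r \<in> X \<nu>"
proof -
  have "is_arg_min (\<lambda>y. \<theta> \<nu> (y + r)) (\<lambda>y. y \<in> X \<nu>) (best_response \<theta> X \<nu> r)"
    using assms unfolding is_best_response_def best_response_def arg_min_on_def arg_min_def
    by (rule someI)
  then show ?thesis by (simp add: is_arg_min_def)
qed

text \<open>The simultaneous update of all players as one self-map of the whole space, so that
  equilibria become its feasible fixed points.\<close>

definition joint_best_response ::
  "('n::finite \<Rightarrow> 'p) \<Rightarrow> ('p \<Rightarrow> real ^ 'n \<Rightarrow> real) \<Rightarrow> ('p \<Rightarrow> (real ^ 'n) set) \<Rightarrow> real ^ 'n \<Rightarrow> real ^ 'n"
  where "joint_best_response own \<theta> X x =
    (\<chi> j. best_response \<theta> X (own j) (rivals own (own j) x) $ j)"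

lemma strategy_joint_best_response:
  assumes "best_response \<theta> X \<nu> (rivals own \<nu> x) \<in> strategy_space own \<nu>"
  shows "strategy own \<nu> (joint_best_response own \<theta> X x) = best_response \<theta> X \<nu> (rivals own \<nu> x)"
  using assms by (auto simp: strategy_def joint_best_response_def strategy_space_def vec_eq_iff)

text \<open>For a base below 1 the exponential is decreasing, so a lower bound on the exponent
  bounds the power from above.\<close>

lemma power_nat_ceiling_log_le:
  fixes \<alpha> t :: real
  assumes "0 < \<alpha>" "\<alpha> < 1" "0 < t" "\<lceil>log \<alpha> t\<rceil> \<le> int n"
  shows "\<alpha> ^ n \<le> t"
proof -
  have "log \<alpha> t \<le> real n" using assms(4) by linarith
  then have "\<alpha> powr real n \<le> \<alpha> powr log \<alpha> t"
    using assms by (intro powr_mono') auto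
  then show ?thesis using assms by (simp add: powr_realpow)
qed

theorem theorem2:
  fixes own :: "'n::finite \<Rightarrow> 'p::finite"
    and \<theta> :: "'p \<Rightarrow> real ^ 'n \<Rightarrow> real"
    and X :: "'p \<Rightarrow> (real ^ 'n) set"
    and nrm :: "'p \<Rightarrow> real ^ 'n \<Rightarrow> real"
    and \<alpha> :: real and w :: "real ^ 'p"
    and x :: "nat \<Rightarrow> real ^ 'n" and J :: "nat \<Rightarrow> 'p set" and h :: nat
  assumes smooth: "\<And>\<nu>. continuously_differentiable (\<theta> \<nu>)"
    and convex_own: "\<And>\<nu> z. convex_on (strategy_space own \<nu>) (\<lambda>y. \<theta> \<nu> (y + rivals own \<nu> z))"
    and strategies: "\<And>\<nu>. X \<nu> \<subseteq> strategy_space own \<nu> \<and> X \<nu> \<noteq> {} \<and> closed (X \<nu>) \<and> convex (X \<nu>)"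
    and solvable: "\<And>\<nu> z. z \<in> feasible own X \<Longrightarrow> \<exists>y. is_best_response \<theta> X \<nu> (rivals own \<nu> z) y"
    and single_valued: "\<And>\<nu> z. z \<in> feasible own X \<Longrightarrow>
          \<exists>\<^sub>\<le>\<^sub>1 y. is_best_response \<theta> X \<nu> (rivals own \<nu> z) y"
    and norms: "\<And>\<nu>. is_norm_on (strategy_space own \<nu>) (nrm \<nu>)"
    and A: "assumption_A own \<theta> X nrm \<alpha> w"
    and jacobi: "jacobi_sequence own \<theta> X J x"
    and h: "h \<ge> 1"
    and cover: "\<And>\<nu> k. \<nu> \<in> (\<Union>t\<in>{k..k + h - 1}. J t)"
  shows "(\<exists>!xbar. equilibrium own \<theta> X xbar) \<and>
    (\<forall>xbar. equilibrium own \<theta> X xbar \<longrightarrow>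
       (x 0 \<noteq> xbar \<longrightarrow> \<alpha> > 0 \<longrightarrow>
          (\<forall>\<epsilon>>0. \<forall>k. int k \<ge> int h * \<lceil>log \<alpha> (min (\<epsilon> /
                (MAX \<nu>. w $ \<nu> * nrm \<nu> (strategy own \<nu> (x 0) - strategy own \<nu> xbar))) 1)\<rceil> \<longrightarrow>
              (MAX \<nu>. w $ \<nu> * nrm \<nu> (strategy own \<nu> (x k) - strategy own \<nu> xbar)) \<le> \<epsilon>)) \<and>
       x \<longlonglongrightarrow> xbar)"
proof -
  define G where "G v = (MAX \<nu>. w $ \<nu> * nrm \<nu> (strategy own \<nu> v))" for v
  define F where "F = feasible own X"
  define T where "T = joint_best_response own \<theta> X"
  note G_diff = linear_diff[OF linear_strategy[of own]]
  have \<alpha>: "0 \<le> \<alpha>" "\<alpha> < 1" and w: "\<And>\<nu>. 0 < w $ \<nu>"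
    using A by (auto simp: assumption_A_def)
  have G_norm: "is_norm_on UNIV G"
    unfolding G_def using norms w by (rule is_norm_on_weighted_max)
  have response_in: "best_response \<theta> X \<nu> (rivals own \<nu> z) \<in> X \<nu>" if "z \<in> F" for z \<nu>
    using solvable[of z \<nu>] that unfolding F_def by (auto intro: best_response_in_strategies)
  \<comment> \<open>A response lies in \<open>X \<nu>\<close>, hence vanishes off the coordinates of
    \<open>\<nu>\<close>, and the projection returns it intact.\<close>
  have strategy_T: "strategy own \<nu> (T z) = best_response \<theta> X \<nu> (rivals own \<nu> z)"
    if "z \<in> F" for z \<nu>
    unfolding T_def using response_in[OF that, of \<nu>] strategies[of \<nu>]
    by (intro strategy_joint_best_response) auto
  have T_in: "T ` F \<subseteq> F"
    using strategy_T response_in by (auto simp: F_def feasible_def)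
  have contraction: "G (T y - T z) \<le> \<alpha> * G (y - z)" if "y \<in> F" "z \<in> F" for y z
    using A that strategy_T unfolding assumption_A_def G_def F_def G_diff by simp
  have x_in: "x k \<in> F" for k
  proof (induction k)
    case 0
    show ?case using jacobi by (simp add: F_def jacobi_sequence_def)
  next
    case (Suc k)
    then show ?case
      using jacobi response_in[OF Suc]
      by (auto simp: F_def feasible_def jacobi_sequence_def)
  qed
  have "closed F"
    unfolding F_def using strategies by (intro closed_feasible) auto
  \<comment> \<open>Nonemptiness of \<open>F\<close> is witnessed by the iterates of the
    method.\<close>
  then have unique: "\<exists>!y. y \<in> F \<and> T y = y"
    using x_in T_in \<alpha> contraction by (intro contraction_unique_fixpoint[OF G_norm]) auto
  have equilibrium_iff: "equilibrium own \<theta> X y \<longleftrightarrow> y \<in> F \<and> T y = y" for y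
    using strategy_T[of y] strategy_eq_iff[of "T y" y own]
    by (auto simp: equilibrium_def F_def)
  have rate: "G (x k - xbar) \<le> \<alpha> ^ (k div h) * G (x 0 - xbar)"
    if "equilibrium own \<theta> X xbar" for xbar k
  proof -
    from that have xbar: "xbar \<in> F" "T xbar = xbar" by (auto simp: equilibrium_iff)
    let ?d = "\<lambda>k \<nu>. w $ \<nu> * nrm \<nu> (strategy own \<nu> (x k - xbar))"
    have strategy_Suc: "strategy own \<nu> (x (Suc k)) =
        (if \<nu> \<in> J k then strategy own \<nu> (T (x k)) else strategy own \<nu> (x k))" for k \<nu>
      using jacobi x_in strategy_T by (simp add: jacobi_sequence_def)
    have "(MAX \<nu>. ?d k \<nu>) \<le> \<alpha> ^ (k div h) * (MAX \<nu>. ?d 0 \<nu>)"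
    proof (rule asynchronous_error_bound)
      show "0 \<le> ?d k \<nu>" for k \<nu>
        using norms[of \<nu>] w[of \<nu>] strategy_in_strategy_space[of own \<nu>]
        by (auto simp: is_norm_on_def)
      show "?d (Suc k) \<nu> \<le> \<alpha> * (MAX \<mu>. ?d k \<mu>)" if "\<nu> \<in> J k" for k \<nu>
      proof -
        \<comment> \<open>As \<open>xbar\<close> is fixed by \<open>T\<close>, the error of an
          updated player is a component of \<open>T (x k) - T xbar\<close>.\<close>
        have "?d (Suc k) \<nu> = w $ \<nu> * nrm \<nu> (strategy own \<nu> (T (x k) - T xbar))"
          using that xbar(2) by (simp add: G_diff strategy_Suc)
        also have "\<dots> \<le> G (T (x k) - T xbar)"
          unfolding G_def by (rule le_Max_range)
        also have "\<dots> \<le> \<alpha> * G (x k - xbar)"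
          using contraction x_in xbar(1) by blast
        finally show ?thesis by (simp add: G_def)
      qed
      show "?d (Suc k) \<nu> = ?d k \<nu>" if "\<nu> \<notin> J k" for k \<nu>
        using that by (simp add: G_diff strategy_Suc)
      \<comment> \<open>The two index ranges agree because \<open>h \<ge> 1\<close> keeps the
        natural subtraction in \<open>k + h - 1\<close> from truncating.\<close>
      show "\<nu> \<in> (\<Union>t\<in>{k..<k + h}. J t)" for k \<nu>
        using cover[of \<nu> k] h by fastforce
    qed (use \<alpha> in auto)
    then show ?thesis by (simp add: G_def)
  qed
  have accuracy: "G (x k - xbar) \<le> \<epsilon>"
    if eq: "equilibrium own \<theta> X xbar" and "x 0 \<noteq> xbar" "\<alpha> > 0" "\<epsilon> > 0"
      and k: "int k \<ge> int h * \<lceil>log \<alpha> (min (\<epsilon> / G (x 0 - xbar)) 1)\<rceil>" for xbar \<epsilon> k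
  proof -
    have G0: "G (x 0 - xbar) > 0"
      using G_norm that(2) by (simp add: is_norm_on_def less_le)
    \<comment> \<open>The ceiling is an integer, so rounding \<open>k / h\<close> down to the number
      of complete blocks preserves the bound.\<close>
    have "\<lceil>log \<alpha> (min (\<epsilon> / G (x 0 - xbar)) 1)\<rceil> \<le> int k div int h"
      using k h zdiv_mono1[OF k, of "int h"] by simp
    then have "\<alpha> ^ (k div h) \<le> min (\<epsilon> / G (x 0 - xbar)) 1"
      using that(3,4) \<alpha> G0 by (intro power_nat_ceiling_log_le) (auto simp: zdiv_int)
    then have "\<alpha> ^ (k div h) * G (x 0 - xbar) \<le> \<epsilon>"
      using G0 by (simp add: pos_le_divide_eq)
    with rate[OF eq] show ?thesis using order_trans by blast
  qed
  \<comment> \<open>Derived from \<open>rate\<close> rather than \<open>accuracy\<close>, so that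
    \<open>\<alpha> = 0\<close> is covered; dividing by \<open>c\<close> turns the rate into one for
    the Euclidean norm.\<close>
  have limit: "x \<longlonglongrightarrow> xbar" if eq: "equilibrium own \<theta> X xbar" for xbar
  proof -
    obtain c where c: "c > 0" "\<And>v. c * norm v \<le> G v"
      using is_norm_on_UNIV_equivalent[OF G_norm] by metis
    have "filterlim (\<lambda>k. k div h) at_top sequentially"
      using h by (intro filterlim_at_top_div_const_nat) simp
    then have "(\<lambda>k. \<alpha> ^ (k div h)) \<longlonglongrightarrow> 0"
      using filterlim_compose[OF LIMSEQ_realpow_zero[OF \<alpha>]] by blast
    then have "(\<lambda>k. \<alpha> ^ (k div h) * (G (x 0 - xbar) / c)) \<longlonglongrightarrow> 0"
      by (rule tendsto_mult_left_zero)
    moreover have "norm (x k - xbar) \<le> \<alpha> ^ (k div h) * (G (x 0 - xbar) / c)" for k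
      using order_trans[OF c(2) rate[OF eq]] c(1) by (simp add: pos_le_divide_eq mult.commute)
    ultimately have "(\<lambda>k. x k - xbar) \<longlonglongrightarrow> 0"
      by (rule Lim_null_comparison[OF always_eventually[OF allI], rotated])
    then show ?thesis by (rule LIM_zero_cancel)
  qed
  show ?thesis
    using unique accuracy limit unfolding equilibrium_iff[symmetric] G_def G_diff by blast
qed

end
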